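(* Let $(1,b,c)$ be a Markoff triple with $c$ odd, $c>1$ and $b\le c$. Let $D=9c^2-4$, $\omega=\frac{1+\sqrt D}{2}$, let $k$ be the integer with $k\equiv b\pmod c$, $0\le k<c$, and let $\mathcal{I}_c=\mathbb{Z}c+\mathbb{Z}\left(k+\tfrac{c-1}{2}+\omega\right)$, $\Lambda_c=\psi(\mathcal{I}_c)$. For $i=1,2$ let $$\beta_i=\left\lfloor\frac{-k\mp\sqrt{3c^2/2-1}}{c}\right\rfloor\quad(\text{minus sign for }i=1),\qquad B_i=\left\{c,\ \beta_ic+k+\tfrac{c-1}{2}+\omega\right\}.$$ Then $\beta_1=-2$ and $\beta_2=0$, so $B_1=\{c,-2c+k+\frac{c-1}{2}+\omega\}$ and $B_2=\{c,k+\frac{c-1}{2}+\omega\}$; both are good for twisting, and the cosines $\cos\theta_i$ of the minimal angles of the corresponding well-rounded twists satisfy $\cos\theta_1=0$ and $\lim_{c\to\infty}\cos\theta_2=\frac{6-4\sqrt5}{11}$ (limit over such triples). Furthermore, there are infinitely many Markoff triples of the form $(1,b,c)$ with $c$ odd; such triples are given by $(1,F_{2n-1},F_{2n+1})$ with $F_{2n+1}$ odd.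
   Context: A Markoff triple is a triple $(a,b,c)$ of nonnegative integers with $a^2+b^2+c^2=3abc$. Fibonacci numbers: $F_1=F_2=1$, $F_n=F_{n-1}+F_{n-2}$. For $z=u+v\sqrt D$ ($u,v\in\mathbb{Q}$) put $\bar z=u-v\sqrt D$ and $\psi(z)=(z,\bar z)\in\mathbb{R}^2$. For $\alpha>0$, $T_\alpha=\mathrm{diag}(\alpha,1/\alpha)$. A basis $\{u,v\}$ of a planar lattice is minimal if $\|u\|=\|v\|$ and $|\langle u,v\rangle|\le\frac12\|u\|\|v\|$. A basis $\{x,y\}$ of $\mathcal{I}_c$ is good for twisting if there is $\alpha>0$ with $T_\alpha\Lambda_c$ well-rounded and $\{T_\alpha\psi(x),T_\alpha\psi(y)\}$ a minimal basis; then $\cos\theta$ denotes the cosine of the angle between $T_\alpha\psi(x)$ and $T_\alpha\psi(y)$, which equals $(x\bar x+y\bar y)/(x\bar y+\bar x y)$. *)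

theory Defs
  imports "HOL-Analysis.Analysis" "HOL-Number_Theory.Fib"
begin

definition markoff_triple :: "nat \<Rightarrow> nat \<Rightarrow> nat \<Rightarrow> bool" where
  "markoff_triple a b c \<longleftrightarrow> a\<^sup>2 + b\<^sup>2 + c\<^sup>2 = 3 * a * b * c"

text \<open>Elements of \<open>\<rat>(\<surd>D)\<close> are real numbers. The conjugate is meaningful only for \<open>z\<close> in this
  field and \<open>\<surd>D\<close> irrational; for \<open>D = 9c\<^sup>2 - 4\<close> with \<open>c \<ge> 1\<close> the latter always holds.\<close>

definition qconj :: "real \<Rightarrow> real \<Rightarrow> real" where
  "qconj D z = (THE w. \<exists>u\<in>\<rat>. \<exists>v\<in>\<rat>. z = u + v * sqrt D \<and> w = u - v * sqrt D)"

definition psi :: "real \<Rightarrow> real \<Rightarrow> real ^ 2" where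
  "psi D z = vector [z, qconj D z]"

definition twist :: "real \<Rightarrow> real ^ 2 ^ 2" where
  "twist \<alpha> = vector [vector [\<alpha>, 0], vector [0, 1 / \<alpha>]]"

definition zspan2 :: "'a::real_vector \<Rightarrow> 'a \<Rightarrow> 'a set" where
  "zspan2 x y = {of_int m *\<^sub>R x + of_int n *\<^sub>R y | m n :: int. True}"

definition zmodule_basis :: "real set \<Rightarrow> real \<Rightarrow> real \<Rightarrow> bool" where
  "zmodule_basis I x y \<longleftrightarrow>
     I = zspan2 x y \<and> (\<forall>m n :: int. of_int m * x + of_int n * y = 0 \<longrightarrow> m = 0 \<and> n = 0)"

text \<open>The condition \<open>u \<noteq> v\<close> is needed because \<open>independent {u, v}\<close> also holds for \<open>u = v \<noteq> 0\<close>.\<close>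

definition lattice_basis :: "(real ^ 2) set \<Rightarrow> real ^ 2 \<Rightarrow> real ^ 2 \<Rightarrow> bool" where
  "lattice_basis L u v \<longleftrightarrow> u \<noteq> v \<and> independent {u, v} \<and> L = zspan2 u v"

definition minimal_basis :: "(real ^ 2) set \<Rightarrow> real ^ 2 \<Rightarrow> real ^ 2 \<Rightarrow> bool" where
  "minimal_basis L u v \<longleftrightarrow>
     lattice_basis L u v \<and> norm u = norm v \<and> \<bar>u \<bullet> v\<bar> \<le> 1 / 2 * norm u * norm v"

definition shortest_vectors :: "(real ^ 2) set \<Rightarrow> (real ^ 2) set" where
  "shortest_vectors L = {v \<in> L. v \<noteq> 0 \<and> (\<forall>w\<in>L. w \<noteq> 0 \<longrightarrow> norm v \<le> norm w)}"

definition well_rounded :: "(real ^ 2) set \<Rightarrow> bool" where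
  "well_rounded L \<longleftrightarrow> span (shortest_vectors L) = UNIV"

definition good_twist :: "real \<Rightarrow> real set \<Rightarrow> real \<Rightarrow> real \<Rightarrow> real \<Rightarrow> bool" where
  "good_twist D I \<alpha> x y \<longleftrightarrow> \<alpha> > 0 \<and>
     well_rounded ((*v) (twist \<alpha>) ` psi D ` I) \<and>
     minimal_basis ((*v) (twist \<alpha>) ` psi D ` I) (twist \<alpha> *v psi D x) (twist \<alpha> *v psi D y)"

definition good_for_twisting :: "real \<Rightarrow> real set \<Rightarrow> real set \<Rightarrow> bool" where
  "good_for_twisting D I B \<longleftrightarrow>
     (\<exists>x y. B = {x, y} \<and> zmodule_basis I x y \<and> (\<exists>\<alpha>. good_twist D I \<alpha> x y))"

text \<open>The angle does not depend on the choice of \<open>\<alpha>\<close> nor on the order of the two basis elements: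
  \<open>\<parallel>T\<^sub>\<alpha> \<psi>(x)\<parallel> = \<parallel>T\<^sub>\<alpha> \<psi>(y)\<parallel>\<close> determines \<open>\<alpha>\<close> when \<open>{x, y}\<close> is a basis.\<close>

definition twist_cos :: "real \<Rightarrow> real set \<Rightarrow> real set \<Rightarrow> real" where
  "twist_cos D I B = (THE t. \<exists>x y \<alpha>. B = {x, y} \<and> good_twist D I \<alpha> x y \<and>
     t = (twist \<alpha> *v psi D x) \<bullet> (twist \<alpha> *v psi D y)
           / (norm (twist \<alpha> *v psi D x) * norm (twist \<alpha> *v psi D y)))"

definition disc :: "nat \<Rightarrow> real" where
  "disc c = 9 * (real c)\<^sup>2 - 4"

definition omega :: "nat \<Rightarrow> real" where
  "omega c = (1 + sqrt (disc c)) / 2"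

definition residue_k :: "nat \<Rightarrow> nat \<Rightarrow> int" where
  "residue_k b c = int b mod int c"

definition second_gen :: "nat \<Rightarrow> nat \<Rightarrow> real" where
  "second_gen b c = of_int (residue_k b c) + (real c - 1) / 2 + omega c"

definition markoff_ideal :: "nat \<Rightarrow> nat \<Rightarrow> real set" where
  "markoff_ideal b c = zspan2 (real c) (second_gen b c)"

definition beta1 :: "nat \<Rightarrow> nat \<Rightarrow> int" where
  "beta1 b c = \<lfloor>(- of_int (residue_k b c) - sqrt (3 * (real c)\<^sup>2 / 2 - 1)) / real c\<rfloor>"

definition beta2 :: "nat \<Rightarrow> nat \<Rightarrow> int" where
  "beta2 b c = \<lfloor>(- of_int (residue_k b c) + sqrt (3 * (real c)\<^sup>2 / 2 - 1)) / real c\<rfloor>"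

definition basis1 :: "nat \<Rightarrow> nat \<Rightarrow> real set" where
  "basis1 b c = {real c, of_int (beta1 b c) * real c + second_gen b c}"

definition basis2 :: "nat \<Rightarrow> nat \<Rightarrow> real set" where
  "basis2 b c = {real c, of_int (beta2 b c) * real c + second_gen b c}"

definition odd_triples :: "(nat \<times> nat) set" where
  "odd_triples = {(b, c). markoff_triple 1 b c \<and> odd c \<and> 1 < c \<and> b \<le> c}"

end

theory Submission
  imports Defs
begin

text \<open>
  If \<open>T\<^sub>\<alpha> \<psi>(x)\<close> and \<open>T\<^sub>\<alpha> \<psi>(y)\<close> have equal norms, then \<open>\<alpha>\<close> drops out of their cosine, which is
  \<open>(xx' + yy') / (xy' + x'y)\<close> with the prime denoting conjugation; such an \<open>\<alpha>\<close> exists iff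
  \<open>(x\<^sup>2 - y\<^sup>2)(y'\<^sup>2 - x'\<^sup>2) > 0\<close> (up to the degenerate case), as it must satisfy
  \<open>\<alpha>\<^sup>4 = (y'\<^sup>2 - x'\<^sup>2) / (x\<^sup>2 - y\<^sup>2)\<close>. For \<open>x = c\<close> and \<open>y = p + \<surd>D/2\<close>, \<open>p = \<beta>c + b + c/2\<close>, the Markoff
  equation gives \<open>yy' = -c\<^sup>2\<close> when \<open>\<beta> = -2\<close>, so the cosine vanishes, and \<open>yy' = 4bc - 3c\<^sup>2\<close> when \<open>\<beta> = 0\<close>,
  so the cosine is \<open>(4b - 2c) / (2b + c)\<close>. Dividing the Markoff equation by \<open>c\<^sup>2\<close> shows that
  \<open>b/c\<close> tends to \<open>(3 - \<surd>5)/2\<close>.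
\<close>

section \<open>Twists of lattices from a real quadratic field\<close>

definition quad_field :: "real \<Rightarrow> real set" where
  "quad_field D = {u + v * sqrt D | u v. u \<in> \<rat> \<and> v \<in> \<rat>}"

text \<open>Two different coefficients of \<open>sqrt D\<close> would exhibit it as a quotient of
  rationals. Uniqueness pins down the description in \<open>qconj\<close> and later yields the
  linear independence required by \<open>zmodule_basis\<close>.\<close>

lemma quad_repr_unique:
  assumes "sqrt D \<notin> \<rat>" "u \<in> \<rat>" "v \<in> \<rat>" "u' \<in> \<rat>" "v' \<in> \<rat>"
    and eq: "u + v * sqrt D = u' + v' * sqrt D"
  shows "u = u' \<and> v = v'"
proof -
  have "v = v'"
  proof (rule ccontr)
    assume "v \<noteq> v'"
    then have "sqrt D = (u' - u) / (v - v')"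
      using eq by (simp add: field_simps)
    moreover have "(u' - u) / (v - v') \<in> \<rat>"
      using assms by (intro Rats_divide Rats_diff)
    ultimately show False
      using assms(1) by simp
  qed
  then show ?thesis
    using eq by simp
qed

lemma qconj_eq:
  assumes "sqrt D \<notin> \<rat>" "u \<in> \<rat>" "v \<in> \<rat>"
  shows "qconj D (u + v * sqrt D) = u - v * sqrt D"
  unfolding qconj_def
proof (rule the_equality)
  show "\<exists>u'\<in>\<rat>. \<exists>v'\<in>\<rat>. u + v * sqrt D = u' + v' * sqrt D \<and> u - v * sqrt D = u' - v' * sqrt D"
    using assms by blast
next
  fix w
  assume "\<exists>u'\<in>\<rat>. \<exists>v'\<in>\<rat>. u + v * sqrt D = u' + v' * sqrt D \<and> w = u' - v' * sqrt D"
  then obtain u' v' where "u' \<in> \<rat>" "v' \<in> \<rat>" "u + v * sqrt D = u' + v' * sqrt D"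
    "w = u' - v' * sqrt D" by blast
  then show "w = u - v * sqrt D"
    using quad_repr_unique[OF assms, of u' v'] by simp
qed

lemma qconj_int_combination:
  assumes D: "sqrt D \<notin> \<rat>" and "x \<in> quad_field D" "y \<in> quad_field D"
  shows "qconj D (of_int m * x + of_int n * y) = of_int m * qconj D x + of_int n * qconj D y"
proof -
  obtain u v where x: "x = u + v * sqrt D" and uv: "u \<in> \<rat>" "v \<in> \<rat>"
    using assms(2) by (auto simp: quad_field_def)
  obtain u' v' where y: "y = u' + v' * sqrt D" and uv': "u' \<in> \<rat>" "v' \<in> \<rat>"
    using assms(3) by (auto simp: quad_field_def)
  have "of_int m * x + of_int n * y
      = (of_int m * u + of_int n * u') + (of_int m * v + of_int n * v') * sqrt D"
    by (simp add: x y algebra_simps)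
  moreover have "qconj D ((of_int m * u + of_int n * u') + (of_int m * v + of_int n * v') * sqrt D)
      = (of_int m * u + of_int n * u') - (of_int m * v + of_int n * v') * sqrt D"
    using uv uv' by (intro qconj_eq D) simp_all
  ultimately show ?thesis
    unfolding x y qconj_eq[OF D uv] qconj_eq[OF D uv'] by (simp add: algebra_simps)
qed

lemma twist_psi_nth:
  "(twist \<alpha> *v psi D z) $ 1 = \<alpha> * z" "(twist \<alpha> *v psi D z) $ 2 = qconj D z / \<alpha>"
  by (simp_all add: twist_def psi_def matrix_vector_mult_def sum_2)

lemma inner_twist_psi:
  "(twist \<alpha> *v psi D x) \<bullet> (twist \<alpha> *v psi D y)
    = \<alpha>\<^sup>2 * (x * y) + qconj D x * qconj D y / \<alpha>\<^sup>2"
  by (simp add: inner_vec_def sum_2 twist_psi_nth power2_eq_square)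

lemma twist_psi_int_combination:
  assumes "sqrt D \<notin> \<rat>" "x \<in> quad_field D" "y \<in> quad_field D"
  shows "twist \<alpha> *v psi D (of_int m * x + of_int n * y)
    = of_int m *\<^sub>R (twist \<alpha> *v psi D x) + of_int n *\<^sub>R (twist \<alpha> *v psi D y)"
  by (simp add: vec_eq_iff forall_2 twist_psi_nth qconj_int_combination[OF assms]
      add_divide_distrib distrib_left mult.left_commute)

lemma twist_psi_zspan2:
  assumes "sqrt D \<notin> \<rat>" "x \<in> quad_field D" "y \<in> quad_field D"
  shows "(*v) (twist \<alpha>) ` psi D ` zspan2 x y = zspan2 (twist \<alpha> *v psi D x) (twist \<alpha> *v psi D y)"
proof -
  have "(*v) (twist \<alpha>) ` psi D ` zspan2 x y
      = {twist \<alpha> *v psi D (of_int m * x + of_int n * y) | m n. True}"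
    unfolding zspan2_def by force
  then show ?thesis
    by (simp add: zspan2_def twist_psi_int_combination[OF assms])
qed

section \<open>Minimal bases of planar lattices\<close>

lemma independent_pair_of_det:
  fixes u v :: "real ^ 2"
  assumes det: "u $ 1 * v $ 2 \<noteq> u $ 2 * v $ 1"
  shows "u \<noteq> v" "independent {u, v}"
proof -
  show "u \<noteq> v"
    using det by auto
  have "v \<noteq> 0"
    using det by auto
  moreover have "u \<notin> span {v}"
    using det by (auto simp: span_singleton)
  ultimately show "independent {u, v}"
    using \<open>u \<noteq> v\<close> by (simp add: independent_insert)
qed

text \<open>Twice the form is \<open>m\<^sup>2 + n\<^sup>2 + (\<bar>m\<bar> -
  \<bar>n\<bar>)\<^sup>2\<close>, hence positive, and a positive integer is at least 1.\<close>

lemma abs_int_form_ge_1: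
  fixes m n :: int
  assumes "m \<noteq> 0 \<or> n \<noteq> 0"
  shows "1 \<le> m\<^sup>2 + n\<^sup>2 - \<bar>m * n\<bar>"
proof -
  have "2 * (m\<^sup>2 + n\<^sup>2 - \<bar>m * n\<bar>) = m\<^sup>2 + n\<^sup>2 + (\<bar>m\<bar> - \<bar>n\<bar>)\<^sup>2"
    by (simp add: power2_eq_square algebra_simps abs_mult)
  moreover have "0 < m\<^sup>2 + n\<^sup>2 + (\<bar>m\<bar> - \<bar>n\<bar>)\<^sup>2"
    using assms by (intro add_pos_nonneg[of "m\<^sup>2 + n\<^sup>2"]) (simp_all only: sum_power2_gt_zero_iff zero_le_power2)
  ultimately have "0 < 2 * (m\<^sup>2 + n\<^sup>2 - \<bar>m * n\<bar>)"
    by (simp only:)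
  then show ?thesis
    by (simp only: zero_less_mult_iff) simp
qed

text \<open>With N the common squared norm, the cross term
  \<open>2 * m * n * (u \<bullet> v)\<close> is at least -|mn| N, so the squared norm of the
  combination is at least N times the form of \<open>abs_int_form_ge_1\<close>.\<close>

lemma norm_le_int_combination:
  fixes u v :: "'a::real_inner"
  assumes uv: "norm u = norm v" "\<bar>u \<bullet> v\<bar> \<le> 1 / 2 * norm u * norm v" and mn: "m \<noteq> 0 \<or> n \<noteq> 0"
  shows "norm u \<le> norm (of_int m *\<^sub>R u + of_int n *\<^sub>R v)"
proof -
  define N where "N = (norm u)\<^sup>2"
  have N: "u \<bullet> u = N" "v \<bullet> v = N" "\<bar>u \<bullet> v\<bar> \<le> N / 2"
    using uv by (simp_all add: N_def power2_norm_eq_inner[symmetric] power2_eq_square)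
  have "\<bar>2 * (of_int (m * n) * (u \<bullet> v))\<bar> \<le> of_int \<bar>m * n\<bar> * N"
    using mult_left_mono[OF N(3), of "2 * of_int \<bar>m * n\<bar>"] by (simp add: abs_mult)
  then have "of_int (m\<^sup>2 + n\<^sup>2 - \<bar>m * n\<bar>) * N
      \<le> (of_int m)\<^sup>2 * N + (of_int n)\<^sup>2 * N + 2 * (of_int (m * n) * (u \<bullet> v))"
    by (simp add: algebra_simps)
  also have "\<dots> = (norm (of_int m *\<^sub>R u + of_int n *\<^sub>R v))\<^sup>2"
    unfolding power2_norm_eq_inner
    by (simp add: inner_add_left inner_add_right N inner_commute[of v u] power2_eq_square algebra_simps)
  finally have "of_int (m\<^sup>2 + n\<^sup>2 - \<bar>m * n\<bar>) * N \<le> (norm (of_int m *\<^sub>R u + of_int n *\<^sub>R v))\<^sup>2" .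
  moreover have "1 * N \<le> of_int (m\<^sup>2 + n\<^sup>2 - \<bar>m * n\<bar>) * N"
    using abs_int_form_ge_1[OF mn] by (intro mult_right_mono)
      (simp_all add: N_def del: of_int_add of_int_diff)
  ultimately have "(norm u)\<^sup>2 \<le> (norm (of_int m *\<^sub>R u + of_int n *\<^sub>R v))\<^sup>2"
    unfolding N_def by linarith
  then show ?thesis
    by (rule power2_le_imp_le) simp
qed

text \<open>Both basis vectors are shortest by \<open>norm_le_int_combination\<close>, and two
  independent vectors span the plane. So a good twist only has to be checked for the minimal
  basis.\<close>

lemma minimal_basis_imp_well_rounded:
  assumes "minimal_basis L u v"
  shows "well_rounded L"
proof -
  have ind: "u \<noteq> v" "independent {u, v}" and L: "L = zspan2 u v"
    and uv: "norm u = norm v" "\<bar>u \<bullet> v\<bar> \<le> 1 / 2 * norm u * norm v"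
    using assms by (auto simp: minimal_basis_def lattice_basis_def)
  have le: "norm u \<le> norm w" if "w \<in> L" "w \<noteq> 0" for w
  proof -
    obtain m n :: int where w: "w = of_int m *\<^sub>R u + of_int n *\<^sub>R v"
      using \<open>w \<in> L\<close> by (auto simp: L zspan2_def)
    then show ?thesis
      using norm_le_int_combination[OF uv, of m n] \<open>w \<noteq> 0\<close>
      by (cases "m = 0 \<and> n = 0") auto
  qed
  have "u = of_int 1 *\<^sub>R u + of_int 0 *\<^sub>R v" "v = of_int 0 *\<^sub>R u + of_int 1 *\<^sub>R v"
    by simp_all
  then have "u \<in> L" "v \<in> L"
    unfolding L zspan2_def by blast+
  moreover have "u \<noteq> 0" "v \<noteq> 0"
    using ind dependent_zero by blast+
  ultimately have "{u, v} \<subseteq> shortest_vectors L"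
    using le uv(1) by (auto simp: shortest_vectors_def)
  moreover have "UNIV \<subseteq> span {u, v}"
    using ind by (intro card_ge_dim_independent) auto
  ultimately show ?thesis
    using span_mono unfolding well_rounded_def by blast
qed

section \<open>Existence and angle of the twist\<close>

text \<open>After clearing the denominator, the two sides differ by \<open>x * x'\<close> times the
  difference of the weighted norms of the two vectors. The weights stand for
  \<open>\<alpha>\<^sup>2\<close> and its inverse, which thus disappear from the cosine.\<close>

lemma cos_of_equal_norms:
  fixes x y x' y' A B :: real
  assumes "A * x\<^sup>2 + B * x'\<^sup>2 = A * y\<^sup>2 + B * y'\<^sup>2" "x * y' + x' * y \<noteq> 0"
  shows "A * (x * y) + B * (x' * y')
    = (x * x' + y * y') / (x * y' + x' * y) * (A * x\<^sup>2 + B * x'\<^sup>2)"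
proof -
  have "(A * (x * y) + B * (x' * y')) * (x * y' + x' * y) - (x * x' + y * y') * (A * x\<^sup>2 + B * x'\<^sup>2)
      = x * x' * ((A * y\<^sup>2 + B * y'\<^sup>2) - (A * x\<^sup>2 + B * x'\<^sup>2))"
    by algebra
  then show ?thesis
    using assms by (simp add: field_simps)
qed

lemma inner_twist_psi_of_equal_norms:
  assumes "norm (twist \<alpha> *v psi D x) = norm (twist \<alpha> *v psi D y)"
    and "x * qconj D y + qconj D x * y \<noteq> 0"
  shows "(twist \<alpha> *v psi D x) \<bullet> (twist \<alpha> *v psi D y)
    = (x * qconj D x + y * qconj D y) / (x * qconj D y + qconj D x * y)
      * ((twist \<alpha> *v psi D x) \<bullet> (twist \<alpha> *v psi D x))"
proof -
  have "(twist \<alpha> *v psi D x) \<bullet> (twist \<alpha> *v psi D x) = (twist \<alpha> *v psi D y) \<bullet> (twist \<alpha> *v psi D y)"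
    using assms(1) by (simp add: power2_norm_eq_inner[symmetric])
  then have "\<alpha>\<^sup>2 * (x * y) + 1 / \<alpha>\<^sup>2 * (qconj D x * qconj D y)
      = (x * qconj D x + y * qconj D y) / (x * qconj D y + qconj D x * y)
        * (\<alpha>\<^sup>2 * x\<^sup>2 + 1 / \<alpha>\<^sup>2 * (qconj D x)\<^sup>2)"
    using assms(2) by (intro cos_of_equal_norms) (simp_all add: inner_twist_psi power2_eq_square)
  then show ?thesis
    by (simp add: inner_twist_psi power2_eq_square)
qed

lemma good_twist_cos:
  assumes gt: "good_twist D I \<alpha> x y"
    and nz: "x * qconj D y + qconj D x * y \<noteq> 0"
  shows "(twist \<alpha> *v psi D x) \<bullet> (twist \<alpha> *v psi D y)
      / (norm (twist \<alpha> *v psi D x) * norm (twist \<alpha> *v psi D y))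
    = (x * qconj D x + y * qconj D y) / (x * qconj D y + qconj D x * y)"
proof -
  define u v where "u = twist \<alpha> *v psi D x" and "v = twist \<alpha> *v psi D y"
  have norm: "norm u = norm v" and "independent {u, v}"
    using gt by (auto simp: good_twist_def minimal_basis_def lattice_basis_def u_def v_def)
  then have "u \<noteq> 0"
    using dependent_zero[of "{u, v}"] by auto
  have "u \<bullet> v = (x * qconj D x + y * qconj D y) / (x * qconj D y + qconj D x * y) * (u \<bullet> u)"
    using norm nz unfolding u_def v_def by (rule inner_twist_psi_of_equal_norms)
  moreover have "norm u * norm v = u \<bullet> u"
    using norm by (simp add: power2_norm_eq_inner[symmetric] power2_eq_square)
  ultimately show ?thesis
    using \<open>u \<noteq> 0\<close> by (simp add: u_def[symmetric] v_def[symmetric])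
qed

text \<open>Each assumption supplies one part of a minimal basis: \<open>det\<close> independence,
  since \<alpha> cancels in the determinant; \<open>pos\<close> a twist equalizing the norms;
  \<open>le\<close>, read through the cosine formula with denominator \<open>nz\<close>, the angle
  condition.\<close>

lemma good_twist_exists:
  assumes D: "sqrt D \<notin> \<rat>" and xy: "x \<in> quad_field D" "y \<in> quad_field D"
    and det: "x * qconj D y \<noteq> qconj D x * y"
    and pos: "(x\<^sup>2 - y\<^sup>2) * ((qconj D y)\<^sup>2 - (qconj D x)\<^sup>2) > 0"
    and nz: "x * qconj D y + qconj D x * y \<noteq> 0"
    and le: "\<bar>(x * qconj D x + y * qconj D y) / (x * qconj D y + qconj D x * y)\<bar> \<le> 1 / 2"
  shows "\<exists>\<alpha>. good_twist D (zspan2 x y) \<alpha> x y"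
proof -
  define t where "t = ((qconj D y)\<^sup>2 - (qconj D x)\<^sup>2) / (x\<^sup>2 - y\<^sup>2)"
  have "x\<^sup>2 - y\<^sup>2 \<noteq> 0" and t: "t > 0"
    using pos by (auto simp: t_def zero_less_mult_iff zero_less_divide_iff)
  define \<alpha> where "\<alpha> = sqrt (sqrt t)"
  have \<alpha>: "\<alpha> > 0" and \<alpha>4: "\<alpha>\<^sup>2 * \<alpha>\<^sup>2 = t"
    using t by (simp_all add: \<alpha>_def)
  define u v where "u = twist \<alpha> *v psi D x" and "v = twist \<alpha> *v psi D y"
  have "\<alpha>\<^sup>2 * \<alpha>\<^sup>2 * (x\<^sup>2 - y\<^sup>2) = (qconj D y)\<^sup>2 - (qconj D x)\<^sup>2"
    using \<open>x\<^sup>2 - y\<^sup>2 \<noteq> 0\<close> unfolding \<alpha>4 by (simp add: t_def)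
  then have eq: "u \<bullet> u = v \<bullet> v"
    using \<alpha> by (simp add: u_def v_def inner_twist_psi field_simps power2_eq_square)
  then have norm: "norm u = norm v"
    by (simp add: norm_eq_sqrt_inner)
  have "u $ 1 * v $ 2 \<noteq> u $ 2 * v $ 1"
    using det \<alpha> by (simp add: u_def v_def twist_psi_nth field_simps)
  note ind = independent_pair_of_det[OF this]
  have "u \<bullet> v = (x * qconj D x + y * qconj D y) / (x * qconj D y + qconj D x * y) * (u \<bullet> u)"
    using norm nz unfolding u_def v_def by (rule inner_twist_psi_of_equal_norms)
  then have "\<bar>u \<bullet> v\<bar> \<le> 1 / 2 * (u \<bullet> u)"
    using mult_right_mono[OF le, of "u \<bullet> u"] by (simp only: abs_mult abs_of_nonneg inner_ge_zero)
  then have "\<bar>u \<bullet> v\<bar> \<le> 1 / 2 * norm u * norm v"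
    using norm by (simp add: power2_norm_eq_inner[symmetric] power2_eq_square)
  then have "minimal_basis (zspan2 u v) u v"
    using ind norm by (simp add: minimal_basis_def lattice_basis_def)
  then have "good_twist D (zspan2 x y) \<alpha> x y"
    using \<alpha> minimal_basis_imp_well_rounded
    by (simp add: good_twist_def twist_psi_zspan2[OF D xy] u_def v_def)
  then show ?thesis ..
qed

text \<open>The formula involves no \<alpha> and is symmetric in \<open>x\<close> and
  \<open>y\<close>, so every admissible choice in the description gives the same value, including
  the swapped order of the set \<open>{x, y}\<close>.\<close>

lemma twist_cos_eq:
  assumes "good_twist D I \<alpha> x y" "x * qconj D y + qconj D x * y \<noteq> 0"
  shows "twist_cos D I {x, y} = (x * qconj D x + y * qconj D y) / (x * qconj D y + qconj D x * y)"
  unfolding twist_cos_def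
proof (rule the_equality)
  show "\<exists>x' y' \<alpha>. {x, y} = {x', y'} \<and> good_twist D I \<alpha> x' y' \<and>
      (x * qconj D x + y * qconj D y) / (x * qconj D y + qconj D x * y)
      = (twist \<alpha> *v psi D x') \<bullet> (twist \<alpha> *v psi D y')
          / (norm (twist \<alpha> *v psi D x') * norm (twist \<alpha> *v psi D y'))"
    using assms(1) good_twist_cos[OF assms] by metis
next
  fix t
  assume "\<exists>x' y' \<alpha>. {x, y} = {x', y'} \<and> good_twist D I \<alpha> x' y' \<and>
      t = (twist \<alpha> *v psi D x') \<bullet> (twist \<alpha> *v psi D y')
          / (norm (twist \<alpha> *v psi D x') * norm (twist \<alpha> *v psi D y'))"
  then obtain x' y' \<alpha>' where "{x, y} = {x', y'}" and gt: "good_twist D I \<alpha>' x' y'"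
    and t: "t = (twist \<alpha>' *v psi D x') \<bullet> (twist \<alpha>' *v psi D y')
      / (norm (twist \<alpha>' *v psi D x') * norm (twist \<alpha>' *v psi D y'))"
    by blast
  then have "x' = x \<and> y' = y \<or> x' = y \<and> y' = x"
    by (auto simp: doubleton_eq_iff)
  then show "t = (x * qconj D x + y * qconj D y) / (x * qconj D y + qconj D x * y)"
    using good_twist_cos[OF gt] assms(2) unfolding t by (auto simp: algebra_simps)
qed

section \<open>Markoff triples containing 1\<close>

lemma markoff_one_iff:
  "markoff_triple 1 b c \<longleftrightarrow> 1 + (int b)\<^sup>2 + (int c)\<^sup>2 = 3 * int b * int c"
proof -
  have "markoff_triple 1 b c \<longleftrightarrow> int (1 + b\<^sup>2 + c\<^sup>2) = int (3 * b * c)"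
    unfolding markoff_triple_def of_nat_eq_iff by simp
  also have "\<dots> \<longleftrightarrow> 1 + (int b)\<^sup>2 + (int c)\<^sup>2 = 3 * int b * int c"
    by (simp only: of_nat_add of_nat_mult of_nat_power of_nat_1 of_nat_numeral)
  finally show ?thesis .
qed

text \<open>The three-term recurrence for odd-indexed Fibonacci numbers is the Vieta move: for fixed
  c, the equation is quadratic in b and its other root is 3c - b.\<close>

lemma fib_odd_step:
  assumes "n \<ge> 1"
  shows "fib (2 * Suc n - 1) = fib (2 * n + 1)"
    "int (fib (2 * Suc n + 1)) = 3 * int (fib (2 * n + 1)) - int (fib (2 * n - 1))"
proof -
  obtain m where "n = Suc m"
    using assms by (cases n) auto
  then show "fib (2 * Suc n - 1) = fib (2 * n + 1)"
    "int (fib (2 * Suc n + 1)) = 3 * int (fib (2 * n + 1)) - int (fib (2 * n - 1))"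
    by (simp_all add: numeral_eq_Suc)
qed

lemma markoff_one_fib:
  assumes "n \<ge> 1"
  shows "markoff_triple 1 (fib (2 * n - 1)) (fib (2 * n + 1))"
  using assms
proof (induction n rule: dec_induct)
  case base
  show ?case
    by (simp add: markoff_triple_def numeral_eq_Suc)
next
  case (step n)
  then show ?case
    unfolding markoff_one_iff fib_odd_step[OF \<open>1 \<le> n\<close>] by algebra
qed

text \<open>Vieta descent: \<open>(b, c)\<close> is replaced by \<open>(3b - c, b)\<close>.\<close>

lemma markoff_one_imp_fib:
  assumes "markoff_triple 1 b c" "b < c"
  shows "\<exists>n\<ge>1. b = fib (2 * n - 1) \<and> c = fib (2 * n + 1)"
  using assms
proof (induction c arbitrary: b rule: less_induct)
  case (less c)
  have eq: "1 + (int b)\<^sup>2 + (int c)\<^sup>2 = 3 * int b * int c"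
    using less.prems(1) by (simp only: markoff_one_iff)
  have "b \<noteq> 0"
    using less.prems(1) unfolding markoff_triple_def by (intro notI) simp
  show ?case
  proof (cases "b = 1")
    case True
    \<comment> \<open>For b = 1 the equation becomes c^2 - 3c + 2 = 0, and c > b leaves c = 2, where
      the descent stops.\<close>
    then have "(int c - 1) * (int c - 2) = 0"
      using eq by (simp add: power2_eq_square algebra_simps)
    then have "c = 2"
      using less.prems(2) True by auto
    then show ?thesis
      using True by (intro exI[of _ 1]) (simp add: numeral_eq_Suc)
  next
    case False
    with \<open>b \<noteq> 0\<close> have b: "int b \<ge> 2"
      by linarith
    define d where "d = 3 * int b - int c"
    \<comment> \<open>The numbers d and c are the two roots of X^2 - 3bX + b^2 + 1; this is their
      product.\<close>
    have prod: "d * int c = (int b)\<^sup>2 + 1"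
      using eq by (simp add: d_def power2_eq_square algebra_simps)
    have "d > 0"
    proof -
      have "0 < d * int c"
        unfolding prod by (simp add: add_nonneg_pos)
      then show ?thesis
        by (simp add: zero_less_mult_iff)
    qed
    moreover have "d < int b"
    proof (rule ccontr)
      assume "\<not> d < int b"
      \<comment> \<open>Since c is at least b + 1, having d at least b would give b^2 + b \<le> b^2
        + 1, against b \<ge> 2.\<close>
      then have "int b * (int b + 1) \<le> d * int c"
        using less.prems(2) by (intro mult_mono) auto
      then show False
        using b unfolding prod by (simp add: power2_eq_square algebra_simps)
    qed
    moreover have "1 + d\<^sup>2 + (int b)\<^sup>2 = 3 * d * int b"
      using eq unfolding d_def by algebra
    ultimately have "markoff_triple 1 (nat d) b" "nat d < b"
      unfolding markoff_one_iff by simp_all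
    then obtain n where n: "n \<ge> 1" "nat d = fib (2 * n - 1)" "b = fib (2 * n + 1)"
      using less.IH[of b "nat d"] less.prems(2) by auto
    then have "int c = int (fib (2 * Suc n + 1))"
      using \<open>d > 0\<close> unfolding fib_odd_step[OF n(1)] d_def by linarith
    then show ?thesis
      using n fib_odd_step(1)[OF n(1)] by (intro exI[of _ "Suc n"]) simp
  qed
qed

lemma odd_triples_fib:
  "odd_triples = {(fib (2 * n - 1), fib (2 * n + 1)) | n. 1 \<le> n \<and> odd (fib (2 * n + 1))}"
    (is "_ = ?F")
proof (intro equalityI subsetI)
  fix z
  assume "z \<in> odd_triples"
  then obtain b c where z: "z = (b, c)" and bc: "markoff_triple 1 b c" "odd c" "1 < c" "b \<le> c"
    by (auto simp: odd_triples_def)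
  have "b \<noteq> c"
    using bc by (auto simp: markoff_triple_def power2_eq_square)
  then show "z \<in> ?F"
    using markoff_one_imp_fib[of b c] bc z by fastforce
next
  fix z
  assume "z \<in> ?F"
  then obtain n where n: "1 \<le> n" "odd (fib (2 * n + 1))"
    and z: "z = (fib (2 * n - 1), fib (2 * n + 1))" by blast
  have "fib (2 * n - 1) \<le> fib (2 * n + 1)"
    by (intro fib_mono) simp
  moreover have "fib 3 \<le> fib (2 * n + 1)"
    using n by (intro fib_mono) simp
  then have "1 < fib (2 * n + 1)"
    by (simp add: numeral_eq_Suc)
  ultimately show "z \<in> odd_triples"
    using n markoff_one_fib[OF n(1)] by (simp add: odd_triples_def z)
qed

section \<open>Parity of Fibonacci numbers and infinitude\<close>

lemma odd_fib_iff: "odd (fib n) \<longleftrightarrow> \<not> 3 dvd n"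
proof (induction n rule: fib.induct)
  case (3 n)
  show ?case
    unfolding fib.simps(3) even_add using 3 by presburger
qed simp_all

lemma le_fib_odd: "n \<le> fib (2 * n + 1)"
proof (induction n)
  case (Suc n)
  have "fib (2 * Suc n + 1) = fib (2 * n + 1) + fib (2 * n + 2)"
    by simp
  moreover have "fib (2 * n + 2) > 0"
    by (intro fib_neq_0_nat) simp
  ultimately show ?case
    using Suc.IH by linarith
qed simp

lemma infinite_odd_triples: "infinite odd_triples"
proof
  assume "finite odd_triples"
  then have "finite (snd ` odd_triples)"
    by simp
  then obtain N where N: "\<And>c. c \<in> snd ` odd_triples \<Longrightarrow> c \<le> N"
    by (meson finite_nat_set_iff_bounded_le)
  \<comment> \<open>This index exceeds N and makes 2n + 1 = 6N + 5, which is not divisible by 3, so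
    the Fibonacci number there is odd and too large for the bound.\<close>
  define n where "n = 3 * N + 2"
  have "\<not> 3 dvd 2 * n + 1"
    unfolding n_def by presburger
  then have "(fib (2 * n - 1), fib (2 * n + 1)) \<in> odd_triples"
    unfolding odd_triples_fib odd_fib_iff by (intro CollectI exI[of _ n]) (simp add: n_def)
  then have "fib (2 * n + 1) \<le> N"
    using N by force
  then show False
    using le_fib_odd[of n] by (simp add: n_def)
qed

section \<open>Size estimates, irrationality and the values of the floors\<close>

text \<open>The ratio b/c is close to (3 - sqrt 5)/2, about 0.382, and is bracketed by rationals.
  The value 3/10 is the threshold at which the second cosine equals -1/2; 9/20 is small enough for
  the floors and for the existence of the second twist.\<close>

lemma odd_triple_bounds:
  assumes "(b, c) \<in> odd_triples"
  shows "real c \<ge> 3" "1 + (real b)\<^sup>2 + (real c)\<^sup>2 = 3 * real b * real c"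
    "3 / 10 * real c \<le> real b" "real b \<le> 9 / 20 * real c"
proof -
  have m: "markoff_triple 1 b c" and c: "odd c" "1 < c" and "b \<le> c"
    using assms by (auto simp: odd_triples_def)
  have "c \<noteq> 2"
    using \<open>odd c\<close> by auto
  then show c3: "real c \<ge> 3"
    using c by simp
  have "real (1 + b\<^sup>2 + c\<^sup>2) = real (3 * b * c)"
    using m unfolding markoff_triple_def by (simp only: power_one mult_1_right)
  then show eq: "1 + (real b)\<^sup>2 + (real c)\<^sup>2 = 3 * real b * real c"
    by simp
  define x y where "x = real b" and "y = real c"
  have xy: "1 + x\<^sup>2 + y\<^sup>2 = 3 * x * y" "y \<ge> 3" "0 \<le> x" "x \<le> y"
    using eq c3 \<open>b \<le> c\<close> by (simp_all add: x_def y_def)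
  show "3 / 10 * real c \<le> real b"
  proof (rule ccontr)
    assume "\<not> 3 / 10 * real c \<le> real b"
    \<comment> \<open>The factor 27/10 is chosen because 3/10 + 27/10 = 3, so that the mixed term
      matches the Markoff equation, which then makes this product -19/100 y^2 - 1.\<close>
    then have "0 < (3 / 10 * y - x) * (27 / 10 * y - x)"
      using xy by (intro mult_pos_pos) (auto simp: x_def y_def)
    then have "0 < 81 / 100 * y\<^sup>2 - 3 * x * y + x\<^sup>2"
      by (simp add: power2_eq_square field_simps)
    moreover have "0 \<le> y\<^sup>2"
      by simp
    ultimately show False
      using xy(1) by linarith
  qed
  show "real b \<le> 9 / 20 * real c"
  proof (rule ccontr)
    assume "\<not> real b \<le> 9 / 20 * real c"
    \<comment> \<open>Again 9/20 + 51/20 = 3. The Markoff equation turns this into 59/400 y^2 \<le>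
      1, which already fails at y = 3.\<close>
    then have "0 \<le> (x - 9 / 20 * y) * (51 / 20 * y - x)"
      using xy by (intro mult_nonneg_nonneg) (auto simp: x_def y_def)
    then have "x\<^sup>2 - 3 * x * y \<le> - (459 / 400) * y\<^sup>2"
      by (simp add: power2_eq_square field_simps)
    moreover have "3\<^sup>2 \<le> y\<^sup>2"
      using xy by (intro power_mono) auto
    ultimately show False
      using xy(1) by (simp add: power2_eq_square)
  qed
qed

text \<open>The integer 9c^2 - 4 lies strictly between the consecutive squares (3c - 1)^2 and
  (3c)^2, and a rational square root of an integer has denominator 1 in lowest terms.\<close>

lemma sqrt_disc_irrational:
  assumes "c \<ge> 1"
  shows "sqrt (disc c) \<notin> \<rat>"
proof
  define d where "d = 9 * (int c)\<^sup>2 - 4"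
  have d: "disc c = of_int d"
    by (simp add: disc_def d_def)
  have d_less: "d < (3 * int c)\<^sup>2" and d_greater: "(3 * int c - 1)\<^sup>2 < d"
    using assms by (auto simp: d_def power2_eq_square algebra_simps)
  assume "sqrt (disc c) \<in> \<rat>"
  then obtain m n :: nat where n: "n \<noteq> 0" and mn: "\<bar>sqrt (disc c)\<bar> = real m / real n" "coprime m n"
    by (rule Rats_abs_nat_div_natE)
  have "disc c \<ge> 0"
    using d_greater zero_le_power2[of "3 * int c - 1"] unfolding d by linarith
  then have "disc c = (real m / real n)\<^sup>2"
    using mn(1) by (metis abs_of_nonneg real_sqrt_ge_0_iff real_sqrt_pow2)
  then have "real_of_int ((int m)\<^sup>2) = real_of_int (d * (int n)\<^sup>2)"
    using n by (simp add: d power_divide field_simps)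
  then have eq: "(int m)\<^sup>2 = d * (int n)\<^sup>2"
    by (simp only: of_int_eq_iff)
  then have "(int n)\<^sup>2 dvd (int m)\<^sup>2"
    by simp
  then have "n dvd m"
    by simp
  then have "n = 1"
    using mn(2) by (simp add: coprime_absorb_right)
  then have "(3 * int c - 1)\<^sup>2 < (int m)\<^sup>2" "(int m)\<^sup>2 < (3 * int c)\<^sup>2"
    using eq d_less d_greater by simp_all
  then have "3 * int c - 1 < int m" "int m < 3 * int c"
    by (auto intro: power2_less_imp_less)
  then show False
    by simp
qed

lemma residue_k_odd_triple:
  assumes "(b, c) \<in> odd_triples"
  shows "residue_k b c = int b"
proof -
  have "real b < real c"
    using odd_triple_bounds[OF assms] by linarith
  then show ?thesis
    by (simp add: residue_k_def)
qed

text \<open>The square root divided by c is near sqrt(3/2), about 1.22, and lies between 11/10 and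
  5/4. With the bounds on b/c, the two quotients fall in [-1.7, -1.4] and [0.65, 0.95].\<close>

lemma beta_eq:
  assumes "(b, c) \<in> odd_triples"
  shows "beta1 b c = -2" "beta2 b c = 0"
proof -
  note bounds = odd_triple_bounds[OF assms]
  define S where "S = sqrt (3 * (real c)\<^sup>2 / 2 - 1)"
  have c9: "3\<^sup>2 \<le> (real c)\<^sup>2"
    using bounds(1) by (intro power_mono) auto
  have "S \<le> sqrt ((5 / 4 * real c)\<^sup>2)"
    unfolding S_def using c9 by (intro real_sqrt_le_mono) (simp add: power2_eq_square)
  then have upper: "S \<le> 5 / 4 * real c"
    using bounds(1) by simp
  have "sqrt ((11 / 10 * real c)\<^sup>2) \<le> S"
    unfolding S_def using c9 by (intro real_sqrt_le_mono) (simp add: power2_eq_square)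
  then have lower: "11 / 10 * real c \<le> S"
    using bounds(1) by simp
  show "beta1 b c = -2"
    unfolding beta1_def S_def[symmetric] residue_k_odd_triple[OF assms] floor_eq_iff
    using bounds lower upper by (simp add: field_simps)
  show "beta2 b c = 0"
    unfolding beta2_def S_def[symmetric] residue_k_odd_triple[OF assms] floor_eq_iff
    using bounds lower upper by (simp add: field_simps)
qed

section \<open>The two bases\<close>

text \<open>The change of generators is a unimodular shear, with inverse given by -\<beta>. Hence
  both bases generate the same ideal.\<close>

lemma zspan2_add_int_multiple: "zspan2 x (of_int \<beta> *\<^sub>R x + y) = zspan2 x y"
proof -
  have "of_int m *\<^sub>R x + of_int n *\<^sub>R (of_int \<beta> *\<^sub>R x + y)
      = of_int (m + n * \<beta>) *\<^sub>R x + of_int n *\<^sub>R y" for m n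
    by (simp add: algebra_simps)
  moreover have "of_int m *\<^sub>R x + of_int n *\<^sub>R y
      = of_int (m - n * \<beta>) *\<^sub>R x + of_int n *\<^sub>R (of_int \<beta> *\<^sub>R x + y)" for m n
    by (simp add: algebra_simps)
  ultimately show ?thesis
    unfolding zspan2_def by (intro Collect_cong) metis
qed

text \<open>Treats both values of \<beta> at once. Here \<open>p\<close> is the rational part of the
  second generator, whose irrational part is half of \<open>sqrt (disc c)\<close>;
  \<open>pos\<close> and \<open>le\<close> are the conditions of \<open>good_twist_exists\<close>
  written in terms of \<open>p\<close>.\<close>

lemma markoff_basis_twist:
  fixes \<beta> :: int
  assumes bc: "(b, c) \<in> odd_triples"
    and p: "p = of_int \<beta> * real c + real b + real c / 2" "p \<noteq> 0"
    and pos: "(real c)\<^sup>2 * (2 * p\<^sup>2 + disc c / 2) > (real c) ^ 4 + (p\<^sup>2 - disc c / 4)\<^sup>2"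
    and le: "\<bar>((real c)\<^sup>2 + p\<^sup>2 - disc c / 4) / (2 * real c * p)\<bar> \<le> 1 / 2"
  shows "good_for_twisting (disc c) (markoff_ideal b c) {real c, of_int \<beta> * real c + second_gen b c}"
    and "twist_cos (disc c) (markoff_ideal b c) {real c, of_int \<beta> * real c + second_gen b c}
      = ((real c)\<^sup>2 + p\<^sup>2 - disc c / 4) / (2 * real c * p)"
proof -
  define D s y where "D = disc c" and "s = sqrt (disc c) / 2"
    and "y = of_int \<beta> * real c + second_gen b c"
  have c: "real c \<ge> 3"
    using odd_triple_bounds[OF bc] by simp
  then have irr: "sqrt D \<notin> \<rat>"
    unfolding D_def by (intro sqrt_disc_irrational) simp
  have s2: "s\<^sup>2 = D / 4"
  proof -
    have "3\<^sup>2 \<le> (real c)\<^sup>2"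
      using c by (intro power_mono) auto
    then show ?thesis
      by (simp add: s_def D_def power_divide disc_def)
  qed
  have "s \<noteq> 0"
    using irr by (auto simp: s_def D_def)
  have rats: "p \<in> \<rat>" "real c \<in> \<rat>" "(0::real) \<in> \<rat>" "(1 / 2 :: real) \<in> \<rat>"
    by (simp_all add: p(1))
  have y: "y = p + 1 / 2 * sqrt D" and c_eq: "real c = real c + 0 * sqrt D"
    by (simp_all add: y_def p(1) second_gen_def omega_def residue_k_odd_triple[OF bc] D_def field_simps)
  have fields: "real c \<in> quad_field D" "y \<in> quad_field D"
    unfolding quad_field_def using rats y c_eq by blast+
  have conj_y: "qconj D y = p - s" and conj_c: "qconj D (real c) = real c" and y_s: "y = p + s"
    using qconj_eq[OF irr rats(1,4)] qconj_eq[OF irr rats(2,3)] y by (simp_all add: s_def D_def)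
  have prod: "y * qconj D y = p\<^sup>2 - D / 4"
    unfolding conj_y s2[symmetric] unfolding y_s by (simp add: power2_eq_square algebra_simps)
  have sum: "real c * qconj D y + qconj D (real c) * y = 2 * real c * p"
    unfolding conj_y conj_c unfolding y_s by (simp add: algebra_simps)
  have cos: "(real c * qconj D (real c) + y * qconj D y) / (real c * qconj D y + qconj D (real c) * y)
      = ((real c)\<^sup>2 + p\<^sup>2 - D / 4) / (2 * real c * p)"
    unfolding prod sum unfolding conj_c by (simp add: power2_eq_square)
  have ideal: "markoff_ideal b c = zspan2 (real c) y"
    using zspan2_add_int_multiple[of "real c" \<beta> "second_gen b c"]
    by (simp add: markoff_ideal_def y_def)
  have nz: "real c * qconj D y + qconj D (real c) * y \<noteq> 0"
    unfolding sum using c p(2) by simp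
  have "\<exists>\<alpha>. good_twist D (zspan2 (real c) y) \<alpha> (real c) y"
  proof (rule good_twist_exists[OF irr fields _ _ nz])
    show "real c * qconj D y \<noteq> qconj D (real c) * y"
      using c \<open>s \<noteq> 0\<close> unfolding conj_c conj_y unfolding y_s by simp
    \<comment> \<open>Multiply out, using that y and its conjugate have squares summing to 2p^2 +
      2s^2 and product p^2 - s^2.\<close>
    have "((real c)\<^sup>2 - y\<^sup>2) * ((qconj D y)\<^sup>2 - (qconj D (real c))\<^sup>2)
        = (real c)\<^sup>2 * (2 * p\<^sup>2 + 2 * s\<^sup>2) - (real c) ^ 4 - (p\<^sup>2 - s\<^sup>2)\<^sup>2"
      unfolding conj_c conj_y unfolding y_s by algebra
    then show "((real c)\<^sup>2 - y\<^sup>2) * ((qconj D y)\<^sup>2 - (qconj D (real c))\<^sup>2) > 0"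
      using pos by (simp add: s2 D_def)
    show "\<bar>(real c * qconj D (real c) + y * qconj D y)
        / (real c * qconj D y + qconj D (real c) * y)\<bar> \<le> 1 / 2"
      unfolding cos using le by (simp add: D_def)
  qed
  then obtain \<alpha> where \<alpha>: "good_twist D (markoff_ideal b c) \<alpha> (real c) y"
    unfolding ideal by blast
  have "m = 0 \<and> n = 0" if "of_int m * real c + of_int n * y = 0" for m n :: int
  proof -
    \<comment> \<open>Comparing coefficients of \<open>sqrt D\<close> forces n = 0, and then the
      rational part forces m = 0.\<close>
    have "(of_int m * real c + of_int n * p) + (of_int n * (1 / 2)) * sqrt D = 0 + 0 * sqrt D"
      using that by (simp add: y algebra_simps)
    then have "of_int m * real c + of_int n * p = 0 \<and> of_int n * (1 / 2) = (0::real)"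
      using rats by (intro quad_repr_unique[OF irr]) auto
    then show ?thesis
      using c by auto
  qed
  then have "zmodule_basis (markoff_ideal b c) (real c) y"
    using ideal by (simp add: zmodule_basis_def)
  then show "good_for_twisting (disc c) (markoff_ideal b c)
      {real c, of_int \<beta> * real c + second_gen b c}"
    using \<alpha> unfolding good_for_twisting_def y_def[symmetric] D_def[symmetric] by blast
  show "twist_cos (disc c) (markoff_ideal b c) {real c, of_int \<beta> * real c + second_gen b c}
      = ((real c)\<^sup>2 + p\<^sup>2 - disc c / 4) / (2 * real c * p)"
    using twist_cos_eq[OF \<alpha> nz] unfolding cos by (simp add: y_def D_def)
qed

text \<open>Here p = b - 3c/2, so p^2 contains exactly b^2 - 3bc, which the Markoff equation
  replaces by -1 - c^2. The norm of the second generator becomes -c^2 and cancels that of c.\<close>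

lemma basis1_twist:
  assumes "(b, c) \<in> odd_triples"
  shows "good_for_twisting (disc c) (markoff_ideal b c) (basis1 b c)"
    and "twist_cos (disc c) (markoff_ideal b c) (basis1 b c) = 0"
proof -
  note bounds = odd_triple_bounds[OF assms]
  define p where "p = of_int (-2) * real c + real b + real c / 2"
  have p2: "p\<^sup>2 = 5 / 4 * (real c)\<^sup>2 - 1"
    using bounds(2) by (simp add: p_def power2_eq_square algebra_simps)
  have D: "disc c / 4 = 9 / 4 * (real c)\<^sup>2 - 1"
    by (simp add: disc_def)
  have "p \<noteq> 0"
    using bounds by (simp add: p_def)
  have cos: "((real c)\<^sup>2 + p\<^sup>2 - disc c / 4) / (2 * real c * p) = 0"
    unfolding p2 D by simp
  have "3\<^sup>2 \<le> (real c)\<^sup>2"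
    using bounds(1) by (intro power_mono) auto
  \<comment> \<open>This product is the difference of the two sides of \<open>pos\<close>; the chain
    rewrites it back in terms of \<open>p\<close>.\<close>
  then have "0 < (real c)\<^sup>2 * (5 * (real c)\<^sup>2 - 4)"
    using bounds(1) by (intro mult_pos_pos) simp_all
  also have "\<dots> = (real c)\<^sup>2 * (7 * (real c)\<^sup>2 - 4) - ((real c) ^ 4 + (- (real c)\<^sup>2)\<^sup>2)"
    by algebra
  also have "7 * (real c)\<^sup>2 - 4 = 2 * p\<^sup>2 + disc c / 2"
    by (simp add: p2 disc_def field_simps)
  also have "- (real c)\<^sup>2 = p\<^sup>2 - disc c / 4"
    by (simp add: p2 D)
  finally have pos: "(real c)\<^sup>2 * (2 * p\<^sup>2 + disc c / 2) > (real c) ^ 4 + (p\<^sup>2 - disc c / 4)\<^sup>2"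
    by simp
  have le: "\<bar>0\<bar> \<le> (1 / 2 :: real)"
    by simp
  have basis: "basis1 b c = {real c, of_int (-2) * real c + second_gen b c}"
    by (simp only: basis1_def beta_eq[OF assms])
  show "good_for_twisting (disc c) (markoff_ideal b c) (basis1 b c)"
    and "twist_cos (disc c) (markoff_ideal b c) (basis1 b c) = 0"
    unfolding basis
    by (fact markoff_basis_twist[OF assms p_def \<open>p \<noteq> 0\<close> pos, unfolded cos, OF le])+
qed

lemma basis2_twist:
  assumes "(b, c) \<in> odd_triples"
  shows "good_for_twisting (disc c) (markoff_ideal b c) (basis2 b c)"
    and "twist_cos (disc c) (markoff_ideal b c) (basis2 b c)
      = (4 * real b - 2 * real c) / (2 * real b + real c)"
proof -
  note bounds = odd_triple_bounds[OF assms]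
  define p where "p = of_int 0 * real c + real b + real c / 2"
  have p2: "p\<^sup>2 = 4 * real b * real c - 3 / 4 * (real c)\<^sup>2 - 1"
    using bounds(2) by (simp add: p_def power2_eq_square algebra_simps)
  have D: "disc c / 4 = 9 / 4 * (real c)\<^sup>2 - 1"
    by (simp add: disc_def)
  have "p \<noteq> 0"
    using bounds by (simp add: p_def)
  have "((real c)\<^sup>2 + p\<^sup>2 - disc c / 4) / (2 * real c * p)
      = (real c * (4 * real b - 2 * real c)) / (real c * (2 * real b + real c))"
    unfolding p2 D by (simp add: p_def power2_eq_square algebra_simps)
  then have cos: "((real c)\<^sup>2 + p\<^sup>2 - disc c / 4) / (2 * real c * p)
      = (4 * real b - 2 * real c) / (2 * real b + real c)"
    using bounds(1) by simp
  \<comment> \<open>The lower bound on the cosine is equivalent to b \<ge> 3c/10.\<close>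
  have le: "\<bar>(4 * real b - 2 * real c) / (2 * real b + real c)\<bar> \<le> 1 / 2"
    using bounds by (simp add: abs_le_iff field_simps)
  \<comment> \<open>The difference of the two sides of \<open>pos\<close>, after eliminating b^2 by
    the Markoff equation; 9c - 16b is nonnegative because b \<le> 9c/20.\<close>
  have "0 < (real c)\<^sup>2 * (real c * (9 * real c - 16 * real b) + 12)"
    using bounds by (intro mult_pos_pos add_nonneg_pos mult_nonneg_nonneg) auto
  also have "\<dots> = (real c)\<^sup>2 * (8 * real b * real c + 3 * (real c)\<^sup>2 - 4)
      - ((real c) ^ 4 + (4 * real b * real c - 3 * (real c)\<^sup>2)\<^sup>2)"
    using bounds(2) by algebra
  also have "8 * real b * real c + 3 * (real c)\<^sup>2 - 4 = 2 * p\<^sup>2 + disc c / 2"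
    by (simp add: p2 disc_def field_simps)
  also have "4 * real b * real c - 3 * (real c)\<^sup>2 = p\<^sup>2 - disc c / 4"
    by (simp add: p2 D)
  finally have pos: "(real c)\<^sup>2 * (2 * p\<^sup>2 + disc c / 2) > (real c) ^ 4 + (p\<^sup>2 - disc c / 4)\<^sup>2"
    by simp
  have basis: "basis2 b c = {real c, of_int 0 * real c + second_gen b c}"
    by (simp only: basis2_def beta_eq[OF assms])
  show "good_for_twisting (disc c) (markoff_ideal b c) (basis2 b c)"
    and "twist_cos (disc c) (markoff_ideal b c) (basis2 b c)
      = (4 * real b - 2 * real c) / (2 * real b + real c)"
    unfolding basis
    by (fact markoff_basis_twist[OF assms p_def \<open>p \<noteq> 0\<close> pos, unfolded cos, OF le])+
qed

section \<open>The limit of the second cosine\<close>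

text \<open>For r = b/c, completing the square in r^2 - 3r + 1 + 1/c^2 = 0 gives (3 - 2r)^2 = 5 -
  4/c^2, and r < 3/2 selects the smaller root.\<close>

lemma odd_triple_ratio:
  assumes "(b, c) \<in> odd_triples"
  shows "real b / real c = (3 - sqrt (5 - 4 / (real c)\<^sup>2)) / 2"
proof -
  note bounds = odd_triple_bounds[OF assms]
  have "(3 - 2 * real b / real c)\<^sup>2 = 5 - 4 / (real c)\<^sup>2"
    using bounds(1,2) by (simp add: field_simps power2_eq_square)
  moreover have "0 \<le> 3 - 2 * real b / real c"
    using bounds by (simp add: field_simps)
  ultimately have "sqrt (5 - 4 / (real c)\<^sup>2) = 3 - 2 * real b / real c"
    by (metis real_sqrt_unique)
  then show ?thesis
    by simp
qed

lemma tendsto_twist_cos_basis2: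
  "((\<lambda>(b, c). twist_cos (disc c) (markoff_ideal b c) (basis2 b c)) \<longlongrightarrow> (6 - 4 * sqrt 5) / 11)
    (inf (filtercomap snd at_top) (principal odd_triples))"
    (is "(?f \<longlongrightarrow> _) ?F")
proof -
  \<comment> \<open>On odd triples the ratio, and with it the cosine, is a function of c alone, so
    the limit over pairs reduces to an ordinary limit in c.\<close>
  define r where "r c = (3 - sqrt (5 - 4 / (real c)\<^sup>2)) / 2" for c
  define g where "g c = (4 * r c - 2) / (2 * r c + 1)" for c
  have eq: "?f z = g (snd z)" if "z \<in> odd_triples" for z
  proof -
    obtain b c where z: "z = (b, c)"
      by force
    have bc: "(b, c) \<in> odd_triples"
      using that z by simp
    have "?f z = (4 * real b - 2 * real c) / (2 * real b + real c)"
      by (simp add: z basis2_twist[OF bc])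
    also have "\<dots> = (4 * (real b / real c) - 2) / (2 * (real b / real c) + 1)"
      using odd_triple_bounds[OF bc] by (simp add: divide_simps)
    finally show ?thesis
      by (simp add: g_def r_def z odd_triple_ratio[OF bc])
  qed
  have inv: "((\<lambda>c. inverse (real c)) \<longlongrightarrow> 0) at_top"
    by (rule lim_inverse_n)
  have "(r \<longlongrightarrow> (3 - sqrt (5 - 4 * 0\<^sup>2)) / 2) at_top"
    unfolding r_def divide_inverse[of 4] power_inverse[symmetric] by (intro tendsto_intros inv) simp
  then have "(r \<longlongrightarrow> (3 - sqrt 5) / 2) at_top"
    by simp
  moreover have "sqrt 5 \<noteq> 4"
    using real_sqrt_eq_iff[of 5 "4\<^sup>2"] by simp
  then have nz: "2 * ((3 - sqrt 5) / 2) + 1 \<noteq> 0"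
    by (simp add: field_simps)
  ultimately have "(g \<longlongrightarrow> (4 * ((3 - sqrt 5) / 2) - 2) / (2 * ((3 - sqrt 5) / 2) + 1)) at_top"
    unfolding g_def using nz by (intro tendsto_intros)
  \<comment> \<open>The left side is (4 - 2 sqrt 5)/(4 - sqrt 5); rationalizing with 4 + sqrt 5
    gives the denominator 11.\<close>
  moreover have "(4 * ((3 - sqrt 5) / 2) - 2) / (2 * ((3 - sqrt 5) / 2) + 1) = (6 - 4 * sqrt 5) / 11"
    using nz by (simp add: field_simps)
  ultimately have "(g \<longlongrightarrow> (6 - 4 * sqrt 5) / 11) at_top"
    by (simp only:)
  then have "((\<lambda>z. g (snd z)) \<longlongrightarrow> (6 - 4 * sqrt 5) / 11) (filtercomap snd at_top)"
    by (rule filterlim_filtercomapI)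
  then have "((\<lambda>z. g (snd z)) \<longlongrightarrow> (6 - 4 * sqrt 5) / 11) ?F"
    by (rule tendsto_mono[rotated]) simp
  moreover have "eventually (\<lambda>z. g (snd z) = ?f z) ?F"
    unfolding eventually_inf_principal using eq by (intro always_eventually) simp
  ultimately show ?thesis
    by (rule Lim_transform_eventually)
qed

theorem theorem6p6:
  "(\<forall>(b, c) \<in> odd_triples.
      beta1 b c = -2 \<and> beta2 b c = 0 \<and>
      basis1 b c = {real c, -2 * real c + second_gen b c} \<and>
      basis2 b c = {real c, second_gen b c} \<and>
      good_for_twisting (disc c) (markoff_ideal b c) (basis1 b c) \<and>
      good_for_twisting (disc c) (markoff_ideal b c) (basis2 b c) \<and>
      twist_cos (disc c) (markoff_ideal b c) (basis1 b c) = 0) \<and>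
   ((\<lambda>(b, c). twist_cos (disc c) (markoff_ideal b c) (basis2 b c))
      \<longlongrightarrow> (6 - 4 * sqrt 5) / 11) (inf (filtercomap snd at_top) (principal odd_triples)) \<and>
   infinite odd_triples \<and>
   odd_triples = {(fib (2 * n - 1), fib (2 * n + 1)) | n. 1 \<le> n \<and> odd (fib (2 * n + 1))}"
proof (intro conjI ballI)
  fix z
  assume "z \<in> odd_triples"
  then obtain b c where z: "z = (b, c)" and bc: "(b, c) \<in> odd_triples"
    by (cases z) simp
  show "case z of (b, c) \<Rightarrow>
      beta1 b c = -2 \<and> beta2 b c = 0 \<and>
      basis1 b c = {real c, -2 * real c + second_gen b c} \<and>
      basis2 b c = {real c, second_gen b c} \<and>
      good_for_twisting (disc c) (markoff_ideal b c) (basis1 b c) \<and>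
      good_for_twisting (disc c) (markoff_ideal b c) (basis2 b c) \<and>
      twist_cos (disc c) (markoff_ideal b c) (basis1 b c) = 0"
    using beta_eq[OF bc] basis1_twist[OF bc] basis2_twist(1)[OF bc]
    by (simp add: z basis1_def basis2_def)
qed (rule tendsto_twist_cos_basis2, rule infinite_odd_triples, rule odd_triples_fib)

end
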